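(* Let $\mathcal N$ be a neighborhood of $0$, $\mu:\mathcal N\to\mathbb R$ with $\mu(0)=0$, $\mu'(0)>0$ and $\mu(t)=0\Leftrightarrow t=0$ in $\mathcal N$; let $I_+\subset\mathcal N$ be a compact interval within $t>0$ and $\lambda(t)=i\sqrt{\mu(t)}$. Fix any $N\in\mathbb N$ such that $\mu\in C^k$ with $k\ge N+1$. Then there exists a (complex-valued) function $f_N(t,\epsilon)$, being $C^{k-N}$ in $t\in I_+$ and polynomial of degree $N$ in $\epsilon$, such that the transformation $(u,v,t)\mapsto(x,y)$ defined by $$\begin{pmatrix} x \\ y \end{pmatrix}=\begin{pmatrix}f_N(t,\epsilon)&\overline f_N(t,\epsilon)\\ \lambda(t)&-\lambda(t)\end{pmatrix}\begin{pmatrix} u \\ v \end{pmatrix}$$ brings the system $\dot x=y,\ \dot y=-\mu(t)x,\ \dot t=\epsilon$ (for all sufficiently small $\epsilon\geq 0$) into the form $$\dot u=\nu_N(t,\epsilon)u+\mathcal O(\epsilon^{N+1})v,\qquad\dot v=\mathcal O(\epsilon^{N+1})u+\overline\nu_N(t,\epsilon)v,\qquad\dot t=\epsilon.$$ Here $\nu_N(t,\epsilon)=\lambda(t)f_N(t,\epsilon)-\epsilon\lambda(t)^{-1}\lambda'(t)+\mathcal O(\epsilon^{N+1})$ is $C^{k-N-1}$ in $t$, analytic in $\epsilon$, and satisfies $$\nu_N(t,\epsilon)=\lambda(t)-\frac12\lambda(t)^{-1}\lambda'(t)\epsilon+\epsilon^2T_{2,N}(t,\epsilon)$$ for some $T_{2,N}$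 having the same properties.
   Context: Overlines denote complex conjugation (for real $t,\epsilon$). $\mathcal O(\epsilon^{N+1})$ denotes coefficient functions of $(t,\epsilon)$ bounded by $C\epsilon^{N+1}$ uniformly in $t\in I_+$ for all sufficiently small $\epsilon$. *)

theory Defs
  imports
    "HOL-Analysis.Analysis"
    "HOL-Computational_Algebra.Polynomial"
begin

text \<open>The class \<open>C\<^sup>k\<close> on a set; derivatives are taken within the set, hence one-sided at the
  endpoints of a compact interval.\<close>

definition Ck_on :: "nat \<Rightarrow> (real \<Rightarrow> 'a::real_normed_vector) \<Rightarrow> real set \<Rightarrow> bool" where
  "Ck_on k f S \<longleftrightarrow>
     (\<exists>D :: nat \<Rightarrow> real \<Rightarrow> 'a.
        (\<forall>t\<in>S. D 0 t = f t) \<and>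
        (\<forall>j<k. \<forall>t\<in>S. (D j has_vector_derivative D (Suc j) t) (at t within S)) \<and>
        (\<forall>j\<le>k. continuous_on S (D j)))"

text \<open>Analyticity of a complex-valued function of a real variable (the library's
  \<open>analytic_on\<close> is for functions of a complex variable).\<close>

definition real_analytic_on :: "(real \<Rightarrow> complex) \<Rightarrow> real set \<Rightarrow> bool" where
  "real_analytic_on f S \<longleftrightarrow>
     (\<forall>x\<in>S. \<exists>r>0. \<exists>c :: nat \<Rightarrow> complex.
        \<forall>y. \<bar>y - x\<bar> < r \<longrightarrow> (\<lambda>n. c n * of_real (y - x) ^ n) sums f y)"

text \<open>\<open>g(t,\<epsilon>) = \<O>(\<epsilon>\<^sup>m)\<close>, uniformly in \<open>t \<in> I\<close>, for \<open>\<epsilon> \<ge> 0\<close>.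
  The value \<open>\<epsilon> = 0\<close> is included.\<close>

definition unif_bigo :: "real set \<Rightarrow> nat \<Rightarrow> (real \<Rightarrow> real \<Rightarrow> complex) \<Rightarrow> bool" where
  "unif_bigo I m g \<longleftrightarrow>
     (\<exists>C. \<exists>\<epsilon>\<^sub>1>0. \<forall>t\<in>I. \<forall>\<epsilon>. 0 \<le> \<epsilon> \<and> \<epsilon> < \<epsilon>\<^sub>1 \<longrightarrow> norm (g t \<epsilon>) \<le> C * \<epsilon> ^ m)"

definition lam :: "(real \<Rightarrow> real) \<Rightarrow> real \<Rightarrow> complex" where
  "lam \<mu> t = \<i> * of_real (sqrt (\<mu> t))"

definition lam' :: "(real \<Rightarrow> real) \<Rightarrow> real \<Rightarrow> complex" where
  "lam' \<mu> t = vector_derivative (lam \<mu>) (at t)"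

text \<open>Phase space is \<open>\<complex>\<^sup>2 \<times> \<real>\<close>: the variables \<open>u, v\<close> are complex, so \<open>x, y\<close> range over
  \<open>\<complex>\<close> as well. The real solutions of the original system are among the complex ones.\<close>

type_synonym phase = "complex \<times> complex \<times> real"

definition solves :: "(phase \<Rightarrow> phase) \<Rightarrow> real set \<Rightarrow> (real \<Rightarrow> phase) \<Rightarrow> bool" where
  "solves F J z \<longleftrightarrow> (\<forall>s\<in>J. (z has_vector_derivative F (z s)) (at s within J))"

text \<open>The map \<open>\<Phi>\<close> is a change of variables on \<open>\<Omega>\<close> that brings the system \<open>z' = F z\<close> into the
  form \<open>w' = G w\<close>, where \<open>z = \<Phi> w\<close>.\<close>

definition brings_into_form ::
    "phase set \<Rightarrow> (phase \<Rightarrow> phase) \<Rightarrow> (phase \<Rightarrow> phase) \<Rightarrow> (phase \<Rightarrow> phase) \<Rightarrow> bool" where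
  "brings_into_form \<Omega> \<Phi> F G \<longleftrightarrow>
     bij_betw \<Phi> \<Omega> \<Omega> \<and>
     (\<forall>J w. is_interval J \<and> w ` J \<subseteq> \<Omega> \<longrightarrow> (solves F J (\<Phi> \<circ> w) \<longleftrightarrow> solves G J w))"

definition orig_field :: "(real \<Rightarrow> real) \<Rightarrow> real \<Rightarrow> phase \<Rightarrow> phase" where
  "orig_field \<mu> \<epsilon> = (\<lambda>(x, y, t). (y, - of_real (\<mu> t) * x, \<epsilon>))"

definition trafo ::
    "(real \<Rightarrow> real) \<Rightarrow> (real \<Rightarrow> real \<Rightarrow> complex) \<Rightarrow> real \<Rightarrow> phase \<Rightarrow> phase" where
  "trafo \<mu> f \<epsilon> = (\<lambda>(u, v, t).
     (f t \<epsilon> * u + cnj (f t \<epsilon>) * v, lam \<mu> t * u - lam \<mu> t * v, t))"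

definition new_field ::
    "(real \<Rightarrow> real \<Rightarrow> complex) \<Rightarrow> (real \<Rightarrow> real \<Rightarrow> complex) \<Rightarrow> (real \<Rightarrow> real \<Rightarrow> complex)
      \<Rightarrow> real \<Rightarrow> phase \<Rightarrow> phase" where
  "new_field \<nu> g h \<epsilon> = (\<lambda>(u, v, t).
     (\<nu> t \<epsilon> * u + g t \<epsilon> * v, h t \<epsilon> * u + cnj (\<nu> t \<epsilon>) * v, \<epsilon>))"

end

theory Submission
  imports Defs "HOL-Complex_Analysis.Cauchy_Integral_Formula"
begin

text \<open>
  Write \<open>z = (x, y)\<close>, \<open>A\<close> for the matrix of the linear system and \<open>\<Phi>\<close> for the matrix with columns
  \<open>(f, \<lambda>)\<close> and its conjugate (recall \<open>\<lambda>\<close> is purely imaginary). In the new coordinates the system has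
  the matrix \<open>\<Phi>\<^sup>-\<^sup>1 (A \<Phi> - \<epsilon> \<Phi>')\<close>, whose second column is again the conjugate of the first one with
  swapped entries. Its off-diagonal entry \<open>h\<close> satisfies
  \<open>h (f + cnj f) = \<lambda> - \<epsilon> f' - \<lambda> f\<^sup>2 + \<epsilon> (\<lambda>' / \<lambda>) f\<close>, and the diagonal entry is
  \<open>\<nu> = \<lambda> f - \<epsilon> \<lambda>' / \<lambda> + h\<close> (\<open>brings_into_form_trafo\<close>). So the system is diagonal up to the error with
  which \<open>f\<close> solves a Riccati equation with small parameter.

  A formal power series solution \<open>f = 1 + \<epsilon> c\<^sub>1 + \<epsilon>\<^sup>2 c\<^sub>2 + \<dots>\<close> is found recursively (\<open>wkb_coeff\<close>),
  as the linearisation \<open>- 2 \<lambda>\<close> of the leading part is invertible; each step costs one derivative in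
  \<open>t\<close>, so that \<open>c\<^sub>n\<close> is of class \<open>C\<close> of order \<open>k - n\<close> (\<open>Ck_on_wkb_coeff\<close>). Truncating after \<open>\<epsilon>\<^sup>N\<close>
  leaves a residual polynomial in \<open>\<epsilon>\<close> divisible by \<open>\<epsilon>\<close> to the power \<open>N + 1\<close>
  (\<open>coeff_riccati_residual\<close>).

  What remains is bookkeeping. All functions in sight are rational in \<open>\<epsilon>\<close> with coefficients of
  the required regularity in \<open>t\<close>, and the only denominator, \<open>f + cnj f = 2 + \<O>(\<epsilon>)\<close>, is bounded away from 0
  for small \<open>\<epsilon>\<close>, uniformly on the compact interval. This gives the error bounds, the smoothness in
  \<open>t\<close> (\<open>Ck_on_divide_poly\<close>) and the analyticity in \<open>\<epsilon>\<close> (\<open>real_analytic_on_rational\<close>).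
\<close>

section \<open>Calculus of functions of class \<open>C\<^sup>k\<close>\<close>

lemma Ck_on_0: "Ck_on 0 f S \<longleftrightarrow> continuous_on S f"
  unfolding Ck_on_def by (auto cong: continuous_on_cong)

text \<open>This recursive description of the class turns each closure property below into an induction
  on the order, for which the rule of differentiation at hand is the induction step.\<close>

lemma Ck_on_Suc:
  "Ck_on (Suc n) f S \<longleftrightarrow>
     (\<exists>f'. (\<forall>t\<in>S. (f has_vector_derivative f' t) (at t within S)) \<and> Ck_on n f' S)"
proof
  assume "Ck_on (Suc n) f S"
  then obtain D where D: "\<forall>t\<in>S. D 0 t = f t"
      "\<forall>j<Suc n. \<forall>t\<in>S. (D j has_vector_derivative D (Suc j) t) (at t within S)"
      "\<forall>j\<le>Suc n. continuous_on S (D j)"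
    unfolding Ck_on_def by blast
  have "(f has_vector_derivative D 1 t) (at t within S)" if "t \<in> S" for t
    by (rule has_vector_derivative_transform[OF that, where f = "D 0"]) (use D that in auto)
  moreover have "Ck_on n (D 1) S"
    unfolding Ck_on_def by (rule exI[of _ "\<lambda>j. D (Suc j)"]) (use D in auto)
  ultimately show "\<exists>f'. (\<forall>t\<in>S. (f has_vector_derivative f' t) (at t within S)) \<and> Ck_on n f' S"
    by blast
next
  assume "\<exists>f'. (\<forall>t\<in>S. (f has_vector_derivative f' t) (at t within S)) \<and> Ck_on n f' S"
  then obtain f' D where f': "\<And>t. t \<in> S \<Longrightarrow> (f has_vector_derivative f' t) (at t within S)"
    and D: "\<forall>t\<in>S. D 0 t = f' t"
      "\<forall>j<n. \<forall>t\<in>S. (D j has_vector_derivative D (Suc j) t) (at t within S)"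
      "\<forall>j\<le>n. continuous_on S (D j)"
    unfolding Ck_on_def by blast
  have "continuous_on S f"
    using f' by (meson continuous_on_eq_continuous_within has_vector_derivative_continuous)
  then show "Ck_on (Suc n) f S"
    unfolding Ck_on_def
    by (intro exI[of _ "case_nat f D"]) (use f' D in \<open>auto split: nat.split\<close>)
qed

lemma Ck_on_cong:
  assumes "\<And>t. t \<in> S \<Longrightarrow> f t = g t"
  shows "Ck_on n f S \<longleftrightarrow> Ck_on n g S"
  unfolding Ck_on_def using assms by auto

lemma Ck_on_mono: "Ck_on n f S \<Longrightarrow> m \<le> n \<Longrightarrow> Ck_on m f S"
  unfolding Ck_on_def by (erule ex_forward) auto

lemma Ck_on_SucD: "Ck_on (Suc n) f S \<Longrightarrow> Ck_on n f S"
  by (erule Ck_on_mono) simp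

lemma Ck_on_subset:
  assumes "Ck_on n f S" "R \<subseteq> S"
  shows "Ck_on n f R"
proof -
  obtain D where D: "\<forall>t\<in>S. D 0 t = f t"
      "\<forall>j<n. \<forall>t\<in>S. (D j has_vector_derivative D (Suc j) t) (at t within S)"
      "\<forall>j\<le>n. continuous_on S (D j)"
    using assms(1) unfolding Ck_on_def by blast
  have "(D j has_vector_derivative D (Suc j) t) (at t within R)" if "j < n" "t \<in> R" for j t
    using has_vector_derivative_within_subset[OF _ assms(2)] D(2) that assms(2) by blast
  moreover have "continuous_on R (D j)" if "j \<le> n" for j
    using D(3) that assms(2) continuous_on_subset by blast
  ultimately show ?thesis
    unfolding Ck_on_def using D(1) assms(2) by (intro exI[of _ D]) auto
qed

lemma Ck_on_imp_continuous_on: "Ck_on n f S \<Longrightarrow> continuous_on S f"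
  using Ck_on_mono[of n f S 0] by (simp add: Ck_on_0)

text \<open>The family of derivatives in the definition is only taken within the set; on an open set it is
  the two-sided derivative.\<close>

lemma Ck_on_open_derivative:
  assumes "Ck_on (Suc n) f S" "open S"
  shows "Ck_on n (\<lambda>t. vector_derivative f (at t)) S"
    and "t \<in> S \<Longrightarrow> (f has_vector_derivative vector_derivative f (at t)) (at t)"
proof -
  obtain f' where f': "\<forall>t\<in>S. (f has_vector_derivative f' t) (at t within S)" "Ck_on n f' S"
    using assms unfolding Ck_on_Suc by blast
  have *: "(f has_vector_derivative f' t) (at t)" if "t \<in> S" for t
    using bspec[OF f'(1) that] unfolding at_within_open[OF that assms(2)] .
  show "Ck_on n (\<lambda>t. vector_derivative f (at t)) S"
    using f'(2) vector_derivative_at[OF *] Ck_on_cong[of S "\<lambda>t. vector_derivative f (at t)" f'] by simp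
  show "(f has_vector_derivative vector_derivative f (at t)) (at t)" if "t \<in> S"
    using *[OF that] vector_derivative_at[OF *[OF that]] by simp
qed

lemma Ck_on_const [intro]: "Ck_on n (\<lambda>t. c) S"
proof (induction n arbitrary: c)
  case 0
  show ?case by (simp add: Ck_on_0)
next
  case (Suc n)
  show ?case
    unfolding Ck_on_Suc using Suc[of 0] by (intro exI[of _ "\<lambda>t. 0"]) auto
qed

lemma Ck_on_add [intro]:
  "Ck_on n f S \<Longrightarrow> Ck_on n g S \<Longrightarrow> Ck_on n (\<lambda>t. f t + g t) S"
proof (induction n arbitrary: f g)
  case 0
  then show ?case by (simp add: Ck_on_0 continuous_on_add)
next
  case (Suc n)
  obtain f' g' where
    "\<forall>t\<in>S. (f has_vector_derivative f' t) (at t within S)" "Ck_on n f' S"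
    "\<forall>t\<in>S. (g has_vector_derivative g' t) (at t within S)" "Ck_on n g' S"
    using Suc.prems unfolding Ck_on_Suc by blast
  then show ?case
    unfolding Ck_on_Suc
    by (intro exI[of _ "\<lambda>t. f' t + g' t"]) (auto intro: has_vector_derivative_add Suc.IH)
qed

lemma Ck_on_linear:
  assumes "bounded_linear L"
  shows "Ck_on n f S \<Longrightarrow> Ck_on n (\<lambda>t. L (f t)) S"
proof (induction n arbitrary: f)
  case 0
  then show ?case
    by (simp add: Ck_on_0 bounded_linear.continuous_on[OF assms])
next
  case (Suc n)
  then obtain f' where
    "\<forall>t\<in>S. (f has_vector_derivative f' t) (at t within S)" "Ck_on n f' S"
    unfolding Ck_on_Suc by blast
  then show ?case
    unfolding Ck_on_Suc
    by (intro exI[of _ "\<lambda>t. L (f' t)"])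
      (auto intro: bounded_linear.has_vector_derivative[OF assms] Suc.IH)
qed

lemma Ck_on_diff:
  assumes "Ck_on n f S" "Ck_on n g S"
  shows "Ck_on n (\<lambda>t. f t - g t) S"
proof -
  have "Ck_on n (\<lambda>t. - g t) S"
    using Ck_on_linear[OF bounded_linear_minus[OF bounded_linear_ident] assms(2)] by simp
  from Ck_on_add[OF assms(1) this] show ?thesis by simp
qed

lemma Ck_on_sum [intro]:
  "(\<And>i. i \<in> A \<Longrightarrow> Ck_on n (f i) S) \<Longrightarrow> Ck_on n (\<lambda>t. \<Sum>i\<in>A. f i t) S"
  by (induction A rule: infinite_finite_induct) auto

lemma Ck_on_mult [intro]:
  fixes f g :: "real \<Rightarrow> 'a::real_normed_algebra"
  shows "Ck_on n f S \<Longrightarrow> Ck_on n g S \<Longrightarrow> Ck_on n (\<lambda>t. f t * g t) S"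
proof (induction n arbitrary: f g)
  case 0
  then show ?case by (simp add: Ck_on_0 continuous_on_mult)
next
  case (Suc n)
  obtain f' g' where
    f': "\<forall>t\<in>S. (f has_vector_derivative f' t) (at t within S)" "Ck_on n f' S" and
    g': "\<forall>t\<in>S. (g has_vector_derivative g' t) (at t within S)" "Ck_on n g' S"
    using Suc.prems unfolding Ck_on_Suc by blast
  show ?case
    unfolding Ck_on_Suc
    using f' g' Ck_on_SucD[OF Suc.prems(1)] Ck_on_SucD[OF Suc.prems(2)]
    by (intro exI[of _ "\<lambda>t. f t * g' t + f' t * g t"] conjI ballI
        has_vector_derivative_mult Ck_on_add Suc.IH) auto
qed

lemma has_vector_derivative_inverse:
  fixes f :: "real \<Rightarrow> 'a::real_normed_field"
  assumes "(f has_vector_derivative f') (at t within S)" "f t \<noteq> 0"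
  shows "((\<lambda>t. inverse (f t)) has_vector_derivative - f' * (inverse (f t) * inverse (f t)))
           (at t within S)"
  using Deriv.has_derivative_inverse[OF assms(2) assms(1)[unfolded has_vector_derivative_def]]
  unfolding has_vector_derivative_def
  by (rule has_derivative_eq_rhs) (simp add: fun_eq_iff algebra_simps)

lemma Ck_on_inverse:
  fixes f :: "real \<Rightarrow> 'a::real_normed_field"
  assumes "\<And>t. t \<in> S \<Longrightarrow> f t \<noteq> 0"
  shows "Ck_on n f S \<Longrightarrow> Ck_on n (\<lambda>t. inverse (f t)) S"
proof (induction n)
  case 0
  then show ?case using assms by (simp add: Ck_on_0 continuous_on_inverse)
next
  case (Suc n)
  then obtain f' where
    f': "\<forall>t\<in>S. (f has_vector_derivative f' t) (at t within S)" "Ck_on n f' S"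
    unfolding Ck_on_Suc by blast
  have "Ck_on n (\<lambda>t. - f' t) S"
    using Ck_on_linear[OF bounded_linear_minus[OF bounded_linear_ident] f'(2)] by simp
  then show ?case
    unfolding Ck_on_Suc
    using f' Suc.IH[OF Ck_on_SucD[OF Suc.prems]] assms
    by (intro exI[of _ "\<lambda>t. - f' t * (inverse (f t) * inverse (f t))"] conjI ballI
        has_vector_derivative_inverse Ck_on_mult) auto
qed

lemma Ck_on_divide:
  fixes f g :: "real \<Rightarrow> 'a::real_normed_field"
  shows "Ck_on n f S \<Longrightarrow> Ck_on n g S \<Longrightarrow> (\<And>t. t \<in> S \<Longrightarrow> g t \<noteq> 0) \<Longrightarrow> Ck_on n (\<lambda>t. f t / g t) S"
  unfolding divide_inverse by (intro Ck_on_mult Ck_on_inverse)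

lemma Ck_on_sqrt:
  assumes "\<And>t. t \<in> S \<Longrightarrow> f t > 0"
  shows "Ck_on n f S \<Longrightarrow> Ck_on n (\<lambda>t. sqrt (f t)) S"
proof (induction n)
  case 0
  then show ?case by (simp add: Ck_on_0 continuous_on_real_sqrt)
next
  case (Suc n)
  then obtain f' where
    f': "\<forall>t\<in>S. (f has_vector_derivative f' t) (at t within S)" "Ck_on n f' S"
    unfolding Ck_on_Suc by blast
  have "((\<lambda>t. sqrt (f t)) has_vector_derivative f' t * (1/2 * inverse (sqrt (f t)))) (at t within S)"
    if "t \<in> S" for t
    using f'(1) that assms[OF that] unfolding has_real_derivative_iff_has_vector_derivative[symmetric]
    by (auto intro!: derivative_eq_intros simp: field_simps)
  moreover have "Ck_on n (\<lambda>t. f' t * (1/2 * inverse (sqrt (f t)))) S"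
    using Suc assms f'(2)
    by (intro Ck_on_mult Ck_on_const Ck_on_inverse) (auto intro: Ck_on_SucD dest: assms)
  ultimately show ?case
    unfolding Ck_on_Suc by (intro exI conjI ballI) auto
qed

section \<open>Polynomials with coefficients of class \<open>C\<^sup>k\<close>\<close>

text \<open>Functions that are polynomial in \<open>\<epsilon>\<close> and of class \<open>C\<^sup>n\<close> in \<open>t\<close> are represented by families of polynomials
  in \<open>\<epsilon>\<close> indexed by \<open>t\<close>. The common bound on the degrees is what makes the evaluation at \<open>\<epsilon>\<close> a fixed
  finite sum of coefficient functions.\<close>

definition Ck_poly :: "nat \<Rightarrow> real set \<Rightarrow> (real \<Rightarrow> complex poly) \<Rightarrow> bool" where
  "Ck_poly n S p \<longleftrightarrow>
     (\<exists>d. \<forall>t\<in>S. degree (p t) \<le> d) \<and> (\<forall>j. Ck_on n (\<lambda>t. coeff (p t) j) S)"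

lemma Ck_poly_mono: "Ck_poly n S p \<Longrightarrow> m \<le> n \<Longrightarrow> Ck_poly m S p"
  unfolding Ck_poly_def using Ck_on_mono by blast

lemma Ck_poly_subset: "Ck_poly n S p \<Longrightarrow> R \<subseteq> S \<Longrightarrow> Ck_poly n R p"
  unfolding Ck_poly_def using Ck_on_subset by blast

lemma Ck_poly_monom [intro]:
  assumes "Ck_on n c S"
  shows "Ck_poly n S (\<lambda>t. monom (c t) i)"
proof -
  have "Ck_on n (\<lambda>t. coeff (monom (c t) i) j) S" for j
    using assms by (cases "i = j") auto
  then show ?thesis
    unfolding Ck_poly_def using degree_monom_le by blast
qed

lemma Ck_poly_add [intro]:
  assumes "Ck_poly n S p" "Ck_poly n S q"
  shows "Ck_poly n S (\<lambda>t. p t + q t)"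
proof -
  obtain d e where "\<forall>t\<in>S. degree (p t) \<le> d" "\<forall>t\<in>S. degree (q t) \<le> e"
    using assms unfolding Ck_poly_def by blast
  then have "\<forall>t\<in>S. degree (p t + q t) \<le> max d e"
    by (meson degree_add_le max.coboundedI1 max.coboundedI2)
  moreover have "Ck_on n (\<lambda>t. coeff (p t + q t) j) S" for j
    using assms unfolding Ck_poly_def by auto
  ultimately show ?thesis
    unfolding Ck_poly_def by blast
qed

lemma Ck_poly_sum [intro]:
  "(\<And>i. i \<in> A \<Longrightarrow> Ck_poly n S (p i)) \<Longrightarrow> Ck_poly n S (\<lambda>t. \<Sum>i\<in>A. p i t)"
  by (induction A rule: infinite_finite_induct)
    (auto simp: Ck_poly_def[of _ _ "\<lambda>t. 0"])

lemma Ck_poly_mult [intro]: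
  assumes "Ck_poly n S p" "Ck_poly n S q"
  shows "Ck_poly n S (\<lambda>t. p t * q t)"
proof -
  obtain d e where "\<forall>t\<in>S. degree (p t) \<le> d" "\<forall>t\<in>S. degree (q t) \<le> e"
    using assms unfolding Ck_poly_def by blast
  then have "\<forall>t\<in>S. degree (p t * q t) \<le> d + e"
    by (meson add_mono degree_mult_le order_trans)
  moreover have "Ck_on n (\<lambda>t. coeff (p t * q t) j) S" for j
    using assms unfolding Ck_poly_def coeff_mult by (intro Ck_on_sum Ck_on_mult) auto
  ultimately show ?thesis
    unfolding Ck_poly_def by blast
qed

lemma Ck_poly_diff [intro]:
  assumes "Ck_poly n S p" "Ck_poly n S q"
  shows "Ck_poly n S (\<lambda>t. p t - q t)"
proof -
  have "Ck_poly n S (\<lambda>t. p t + monom (- 1) 0 * q t)"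
    using assms by (intro Ck_poly_add Ck_poly_mult Ck_poly_monom Ck_on_const)
  moreover have "monom (- 1) 0 * r = - r" for r :: "complex poly"
    by (simp add: monom_0)
  ultimately show ?thesis
    by simp
qed

lemma Ck_poly_cnj [intro]:
  assumes "Ck_poly n S p"
  shows "Ck_poly n S (\<lambda>t. map_poly cnj (p t))"
  using assms unfolding Ck_poly_def
  by (auto simp: degree_map_poly coeff_map_poly intro: Ck_on_linear[OF bounded_linear_cnj])

lemma degree_poly_shift_le: "degree (poly_shift m p) \<le> degree p"
  by (rule degree_le) (auto simp: coeff_poly_shift coeff_eq_0)

lemma Ck_poly_shift [intro]:
  assumes "Ck_poly n S p"
  shows "Ck_poly n S (\<lambda>t. poly_shift m (p t))"
  using assms unfolding Ck_poly_def coeff_poly_shift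
  by (meson degree_poly_shift_le order_trans)

lemma poly_eq_sum_degree_le:
  fixes p :: "complex poly"
  assumes "degree p \<le> d"
  shows "poly p x = (\<Sum>i\<le>d. coeff p i * x ^ i)"
  unfolding poly_altdef
  by (rule sum.mono_neutral_left) (use assms in \<open>auto simp: coeff_eq_0\<close>)

lemma Ck_on_poly:
  assumes "Ck_poly n S p"
  shows "Ck_on n (\<lambda>t. poly (p t) z) S"
proof -
  obtain d where d: "\<And>t. t \<in> S \<Longrightarrow> degree (p t) \<le> d" and
    c: "\<And>j. Ck_on n (\<lambda>t. coeff (p t) j) S"
    using assms unfolding Ck_poly_def by blast
  have "Ck_on n (\<lambda>t. \<Sum>i\<le>d. coeff (p t) i * z ^ i) S"
    by (intro Ck_on_sum Ck_on_mult c Ck_on_const)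
  then show ?thesis
    using Ck_on_cong[of S "\<lambda>t. poly (p t) z" "\<lambda>t. \<Sum>i\<le>d. coeff (p t) i * z ^ i" n]
      poly_eq_sum_degree_le[OF d] by simp
qed

lemma Ck_on_divide_poly:
  assumes "Ck_poly n S p" "Ck_poly n S q" "\<And>t. t \<in> S \<Longrightarrow> poly (q t) z \<noteq> 0"
  shows "Ck_on n (\<lambda>t. poly (p t) z / poly (q t) z) S"
  unfolding divide_inverse
  using assms by (intro Ck_on_mult Ck_on_inverse Ck_on_poly) auto

lemma Ck_poly_bounded:
  assumes "Ck_poly n S p" "compact S"
  obtains C where "C \<ge> 0" "\<And>t z. t \<in> S \<Longrightarrow> norm z \<le> 1 \<Longrightarrow> norm (poly (p t) z) \<le> C"
proof -
  obtain d where d: "\<And>t. t \<in> S \<Longrightarrow> degree (p t) \<le> d" and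
    c: "\<And>j. Ck_on n (\<lambda>t. coeff (p t) j) S"
    using assms unfolding Ck_poly_def by blast
  have "\<exists>B. \<forall>t\<in>S. norm (coeff (p t) j) \<le> B" for j
    using compact_imp_bounded[OF compact_continuous_image[OF Ck_on_imp_continuous_on[OF c] assms(2)]]
    unfolding bounded_iff by auto
  then obtain B where B: "\<And>j t. t \<in> S \<Longrightarrow> norm (coeff (p t) j) \<le> B j"
    by metis
  show ?thesis
  proof (rule that[of "\<Sum>i\<le>d. \<bar>B i\<bar>"])
    fix t z assume t: "t \<in> S" and z: "norm (z :: complex) \<le> 1"
    have "norm (poly (p t) z) \<le> (\<Sum>i\<le>d. norm (coeff (p t) i * z ^ i))"
      unfolding poly_eq_sum_degree_le[OF d[OF t]] by (rule norm_sum)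
    also have "\<dots> \<le> (\<Sum>i\<le>d. \<bar>B i\<bar> * 1)"
      unfolding norm_mult norm_power
    proof (intro sum_mono mult_mono)
      fix i
      show "norm (coeff (p t) i) \<le> \<bar>B i\<bar>"
        using B[OF t, of i] by linarith
      show "norm z ^ i \<le> 1"
        using z by (simp add: power_le_one)
    qed auto
    finally show "norm (poly (p t) z) \<le> (\<Sum>i\<le>d. \<bar>B i\<bar>)" by simp
  qed (simp add: sum_nonneg)
qed

text \<open>The real power series are restrictions of the complex one: near a real point where the
  denominator does not vanish, the quotient is holomorphic on a complex disc.\<close>

lemma real_analytic_on_rational:
  fixes p q :: "complex poly"
  assumes "open S" and "\<And>x. x \<in> S \<Longrightarrow> poly q (of_real x) \<noteq> 0"
    and "\<And>x. x \<in> S \<Longrightarrow> f x = poly p (of_real x) / poly q (of_real x)"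
  shows "real_analytic_on f S"
  unfolding real_analytic_on_def
proof
  fix x assume x: "x \<in> S"
  let ?F = "\<lambda>z. poly p z / poly q z"
  have "open {z. poly q z \<noteq> 0}"
    by (intro open_Collect_neq continuous_intros)
  then obtain r where r: "r > 0" "ball (of_real x) r \<subseteq> {z. poly q z \<noteq> 0}"
    using assms(2)[OF x] by (auto elim: openE)
  obtain s where s: "s > 0" "ball x s \<subseteq> S"
    using assms(1) x by (rule openE)
  have hol: "?F holomorphic_on ball (of_real x) r"
    using r(2) by (intro holomorphic_intros) auto
  have "(\<lambda>n. (deriv ^^ n) ?F (of_real x) / fact n * of_real (y - x) ^ n) sums f y"
    if "\<bar>y - x\<bar> < min r s" for y
  proof -
    have "dist (complex_of_real x) (of_real y) = \<bar>y - x\<bar>"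
      by (simp add: dist_norm norm_minus_commute flip: of_real_diff)
    moreover have "y \<in> S"
      using that s(2) by (auto simp: dist_real_def subset_iff abs_minus_commute)
    ultimately show ?thesis
      using holomorphic_power_series[OF hol, of "of_real y"] that assms(3)[of y] by simp
  qed
  then show "\<exists>r>0. \<exists>c. \<forall>y. \<bar>y - x\<bar> < r \<longrightarrow> (\<lambda>n. c n * complex_of_real (y - x) ^ n) sums f y"
    using r(1) s(1)
    by (intro exI[of _ "min r s"] conjI exI[of _ "\<lambda>n. (deriv ^^ n) ?F (of_real x) / fact n"]) auto
qed

section \<open>The formal solution of the Riccati equation\<close>

text \<open>Comparison of the coefficients of \<open>\<epsilon>\<close> to the power \<open>n + 1\<close> in
  \<open>l - \<epsilon> f' - l f\<^sup>2 + \<epsilon> (l' / l) f = 0\<close> with \<open>f = \<Sum>c\<^sub>n \<epsilon>\<^sup>n\<close>. The two terms of the square that contain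
  the new coefficient contribute \<open>2 c\<^sub>0 = 2\<close> times it, and the recursion solves for it.\<close>

fun wkb_coeff :: "(real \<Rightarrow> complex) \<Rightarrow> nat \<Rightarrow> real \<Rightarrow> complex" where
  "wkb_coeff l 0 = (\<lambda>t. 1)"
| "wkb_coeff l (Suc n) = (\<lambda>t.
     (vector_derivative l (at t) / l t * wkb_coeff l n t - vector_derivative (wkb_coeff l n) (at t))
       / (2 * l t)
     - (\<Sum>i=1..n. wkb_coeff l i t * wkb_coeff l (Suc n - i) t) / 2)"

(* Coefficients of positive order are to stay folded in the cancellation arguments below. *)
declare wkb_coeff.simps(2) [simp del]

lemma Ck_on_wkb_coeff:
  assumes "open S" "Ck_on k l S" "\<And>t. t \<in> S \<Longrightarrow> l t \<noteq> 0"
  shows "n \<le> k \<Longrightarrow> Ck_on (k - n) (wkb_coeff l n) S"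
proof (induction n rule: less_induct)
  case (less n)
  show ?case
  proof (cases n)
    case 0
    then show ?thesis by auto
  next
    case (Suc m)
    have l: "Ck_on (k - n) l S"
      using assms(2) by (rule Ck_on_mono) simp
    have deriv: "Ck_on (k - n) (\<lambda>t. vector_derivative g (at t)) S"
      if "Ck_on (k - m) g S" for g :: "real \<Rightarrow> complex"
      using that Suc less.prems by (intro Ck_on_open_derivative(1) assms) (simp add: Suc_diff_Suc)
    have l': "Ck_on (k - n) (\<lambda>t. vector_derivative l (at t)) S"
      using assms(2) by (intro deriv) (auto elim: Ck_on_mono)
    have c: "Ck_on (k - n) (wkb_coeff l i) S" if "i < n" for i
      using less.IH[OF that] less.prems that by (auto elim!: Ck_on_mono)
    have c': "Ck_on (k - n) (\<lambda>t. vector_derivative (wkb_coeff l m) (at t)) S"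
      using Suc less by (intro deriv) auto
    have sum: "Ck_on (k - n) (\<lambda>t. \<Sum>i=1..m. wkb_coeff l i t * wkb_coeff l (Suc m - i) t) S"
      using Suc by (intro Ck_on_sum Ck_on_mult c) auto
    show ?thesis
      unfolding Suc wkb_coeff.simps
      using assms(3)
      by (intro Ck_on_diff Ck_on_divide Ck_on_mult Ck_on_const
          l[unfolded Suc] l'[unfolded Suc] c[unfolded Suc] c'[unfolded Suc] sum[unfolded Suc]) auto
  qed
qed

definition wkb_poly :: "(real \<Rightarrow> complex) \<Rightarrow> nat \<Rightarrow> real \<Rightarrow> complex poly" where
  "wkb_poly l N t = (\<Sum>n\<le>N. monom (wkb_coeff l n t) n)"

definition wkb_poly_deriv :: "(real \<Rightarrow> complex) \<Rightarrow> nat \<Rightarrow> real \<Rightarrow> complex poly" where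
  "wkb_poly_deriv l N t = (\<Sum>n\<le>N. monom (vector_derivative (wkb_coeff l n) (at t)) n)"

text \<open>What the truncated series leaves over in the Riccati equation, as a polynomial in \<open>\<epsilon>\<close>.\<close>

definition riccati_residual :: "(real \<Rightarrow> complex) \<Rightarrow> nat \<Rightarrow> real \<Rightarrow> complex poly" where
  "riccati_residual l N t =
     monom (l t) 0 - monom 1 1 * wkb_poly_deriv l N t
     - monom (l t) 0 * (wkb_poly l N t * wkb_poly l N t)
     + monom (vector_derivative l (at t) / l t) 1 * wkb_poly l N t"

lemma coeff_wkb_poly: "coeff (wkb_poly l N t) j = (if j \<le> N then wkb_coeff l j t else 0)"
  unfolding wkb_poly_def coeff_sum coeff_monom by simp

lemma coeff_wkb_poly_deriv:
  "coeff (wkb_poly_deriv l N t) j =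
     (if j \<le> N then vector_derivative (wkb_coeff l j) (at t) else 0)"
  unfolding wkb_poly_deriv_def coeff_sum coeff_monom by simp

lemma degree_wkb_poly: "degree (wkb_poly l N t) \<le> N"
  by (rule degree_le) (simp add: coeff_wkb_poly)

text \<open>Up to order \<open>N\<close> the coefficients of the square of the truncated series agree with those of the
  square of the full formal series, so the recursion for the coefficients makes them cancel.\<close>

lemma coeff_riccati_residual:
  assumes "l t \<noteq> 0" "j \<le> N"
  shows "coeff (riccati_residual l N t) j = 0"
proof (cases j)
  case 0
  then show ?thesis
    by (simp add: riccati_residual_def coeff_monom_mult coeff_mult coeff_wkb_poly)
next
  case (Suc m)
  let ?c = "\<lambda>n. wkb_coeff l n t"
  have "{..Suc m} = insert 0 (insert (Suc m) {1..m})"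
    by auto
  then have "(\<Sum>i\<le>Suc m. ?c i * ?c (Suc m - i)) = 2 * ?c (Suc m) + (\<Sum>i=1..m. ?c i * ?c (Suc m - i))"
    by simp
  also have "\<dots> = (vector_derivative l (at t) / l t * ?c m
      - vector_derivative (wkb_coeff l m) (at t)) / l t"
    using assms(1) by (simp add: wkb_coeff.simps(2) field_simps)
  finally have "l t * (\<Sum>i\<le>Suc m. ?c i * ?c (Suc m - i)) =
      vector_derivative l (at t) / l t * ?c m - vector_derivative (wkb_coeff l m) (at t)"
    using assms(1) by simp
  moreover have "coeff (wkb_poly l N t * wkb_poly l N t) (Suc m) = (\<Sum>i\<le>Suc m. ?c i * ?c (Suc m - i))"
    unfolding coeff_mult by (rule sum.cong) (use assms(2) Suc in \<open>auto simp: coeff_wkb_poly\<close>)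
  ultimately show ?thesis
    using assms(2) Suc
    by (simp add: riccati_residual_def coeff_monom_mult coeff_wkb_poly coeff_wkb_poly_deriv)
qed

lemma poly_eq_power_times_shift:
  fixes p :: "complex poly"
  assumes "\<And>j. j < m \<Longrightarrow> coeff p j = 0"
  shows "poly p z = z ^ m * poly (poly_shift m p) z"
proof -
  have "p = monom 1 m * poly_shift m p"
    using assms by (auto simp: poly_eq_iff coeff_monom_mult coeff_poly_shift)
  then have "poly p z = poly (monom 1 m * poly_shift m p) z" by simp
  then show ?thesis by (simp add: poly_monom)
qed

lemma poly_riccati_residual:
  assumes "l t \<noteq> 0"
  shows "l t - z * poly (wkb_poly_deriv l N t) z - l t * poly (wkb_poly l N t) z ^ 2
      + z * (vector_derivative l (at t) / l t) * poly (wkb_poly l N t) z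
    = z ^ Suc N * poly (poly_shift (Suc N) (riccati_residual l N t)) z"
proof -
  have "poly (riccati_residual l N t) z
      = z ^ Suc N * poly (poly_shift (Suc N) (riccati_residual l N t)) z"
    by (rule poly_eq_power_times_shift) (use assms in \<open>simp add: coeff_riccati_residual\<close>)
  then show ?thesis
    by (simp add: riccati_residual_def poly_monom power2_eq_square algebra_simps)
qed

text \<open>The residual is less regular than the truncated series: it contains the derivative of the last
  coefficient, which costs one order.\<close>

context
  fixes S :: "real set" and k N :: nat and l :: "real \<Rightarrow> complex"
  assumes S: "open S" and l: "Ck_on k l S" and l_nz: "\<And>t. t \<in> S \<Longrightarrow> l t \<noteq> 0"
    and Nk: "N + 1 \<le> k"
begin

lemma Ck_poly_wkb_poly: "Ck_poly (k - N) S (wkb_poly l N)"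
proof -
  have "Ck_on (k - N) (wkb_coeff l n) S" if "n \<le> N" for n
    using Ck_on_mono[OF Ck_on_wkb_coeff[OF S l l_nz, of n]] that Nk by simp
  then have "Ck_poly (k - N) S (\<lambda>t. \<Sum>n\<le>N. monom (wkb_coeff l n t) n)"
    by (intro Ck_poly_sum Ck_poly_monom) auto
  then show ?thesis
    unfolding wkb_poly_def .
qed

lemma Ck_poly_wkb_poly_deriv: "Ck_poly (k - N - 1) S (wkb_poly_deriv l N)"
proof -
  have "Ck_on (k - N - 1) (\<lambda>t. vector_derivative (wkb_coeff l n) (at t)) S" if "n \<le> N" for n
    by (rule Ck_on_open_derivative(1)[OF Ck_on_mono[OF Ck_on_wkb_coeff[OF S l l_nz, of n]] S])
      (use that Nk in auto)
  then have "Ck_poly (k - N - 1) S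
      (\<lambda>t. \<Sum>n\<le>N. monom (vector_derivative (wkb_coeff l n) (at t)) n)"
    by (intro Ck_poly_sum Ck_poly_monom) auto
  then show ?thesis
    unfolding wkb_poly_deriv_def .
qed

lemma Ck_on_log_deriv: "Ck_on (k - N - 1) (\<lambda>t. vector_derivative l (at t) / l t) S"
proof -
  have "Ck_on (k - N - 1) (\<lambda>t. vector_derivative l (at t)) S"
    by (rule Ck_on_open_derivative(1)[OF Ck_on_mono[OF l] S]) (use Nk in auto)
  moreover have "Ck_on (k - N - 1) l S"
    by (rule Ck_on_mono[OF l]) simp
  ultimately show ?thesis
    using l_nz by (intro Ck_on_divide)
qed

lemma Ck_poly_riccati_residual: "Ck_poly (k - N - 1) S (riccati_residual l N)"
proof -
  have "Ck_poly (k - N - 1) S (wkb_poly l N)" "Ck_on (k - N - 1) l S"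
    using Ck_poly_mono[OF Ck_poly_wkb_poly] Ck_on_mono[OF l] by auto
  then have "Ck_poly (k - N - 1) S (\<lambda>t. monom (l t) 0 - monom 1 1 * wkb_poly_deriv l N t
     - monom (l t) 0 * (wkb_poly l N t * wkb_poly l N t)
     + monom (vector_derivative l (at t) / l t) 1 * wkb_poly l N t)"
    by (intro Ck_poly_add Ck_poly_diff Ck_poly_mult Ck_poly_monom Ck_on_const
        Ck_poly_wkb_poly_deriv Ck_on_log_deriv)
  then show ?thesis
    unfolding riccati_residual_def .
qed

lemma wkb_poly_has_vector_derivative:
  assumes "t \<in> S"
  shows "((\<lambda>t. poly (wkb_poly l N t) z) has_vector_derivative poly (wkb_poly_deriv l N t) z) (at t)"
proof -
  have "(wkb_coeff l n has_vector_derivative vector_derivative (wkb_coeff l n) (at t)) (at t)"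
    if "n \<le> N" for n
    by (rule Ck_on_open_derivative(2)[OF Ck_on_mono[OF Ck_on_wkb_coeff[OF S l l_nz, of n], of 1,
          unfolded One_nat_def] S assms])
      (use that Nk in auto)
  then have "((\<lambda>t. \<Sum>n\<le>N. wkb_coeff l n t * z ^ n) has_vector_derivative
      (\<Sum>n\<le>N. vector_derivative (wkb_coeff l n) (at t) * z ^ n)) (at t)"
    by (intro has_vector_derivative_sum has_vector_derivative_mult_left) auto
  then show ?thesis
    by (simp add: wkb_poly_def wkb_poly_deriv_def poly_sum poly_monom)
qed

end

section \<open>The linear change of variables\<close>

lemma has_vector_derivative_triple_iff:
  "((\<lambda>s. (x s, y s, t s)) has_vector_derivative (x', y', t')) (at s within J) \<longleftrightarrow>
     (x has_vector_derivative x') (at s within J) \<and>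
     (y has_vector_derivative y') (at s within J) \<and>
     (t has_vector_derivative t') (at s within J)" (is "?L \<longleftrightarrow> ?R")
proof
  assume L: ?L
  note 1 = bounded_linear.has_vector_derivative[OF bounded_linear_fst L]
  note 2 = bounded_linear.has_vector_derivative[OF bounded_linear_snd L]
  note 3 = bounded_linear.has_vector_derivative[OF bounded_linear_fst 2]
  note 4 = bounded_linear.has_vector_derivative[OF bounded_linear_snd 2]
  show ?R using 1 3 4 by simp
next
  assume ?R
  then show ?L by (auto intro: has_vector_derivative_Pair)
qed

text \<open>The direction from \<open>x, y\<close> to \<open>u, v\<close> solves the linear system for \<open>u\<close> and \<open>v\<close> and differentiates
  the solution. Comparing the derivatives of \<open>x, y\<close> with those obtained from the product rule would
  not do, as derivatives within \<open>J\<close> are not unique when \<open>J\<close> is a single point.\<close>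

lemma linear_change_has_vector_derivative_iff:
  fixes u v p q l :: "real \<Rightarrow> complex"
  assumes s: "s \<in> J"
    and p: "(p has_vector_derivative p') (at s within J)"
    and q: "(q has_vector_derivative q') (at s within J)"
    and l: "(l has_vector_derivative l') (at s within J)"
    and nz: "\<And>r. r \<in> J \<Longrightarrow> l r \<noteq> 0" "\<And>r. r \<in> J \<Longrightarrow> p r + q r \<noteq> 0"
  shows
    "((\<lambda>r. p r * u r + q r * v r) has_vector_derivative
        p s * U + p' * u s + (q s * V + q' * v s)) (at s within J) \<and>
     ((\<lambda>r. l r * u r - l r * v r) has_vector_derivative
        l s * U + l' * u s - (l s * V + l' * v s)) (at s within J) \<longleftrightarrow>
     (u has_vector_derivative U) (at s within J) \<and>
     (v has_vector_derivative V) (at s within J)"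
    (is "(?x has_vector_derivative ?X) _ \<and> (?y has_vector_derivative ?Y) _ \<longleftrightarrow> ?R")
proof
  assume ?R
  then show "(?x has_vector_derivative ?X) (at s within J) \<and>
      (?y has_vector_derivative ?Y) (at s within J)"
    by (intro conjI has_vector_derivative_add has_vector_derivative_diff has_vector_derivative_mult
        p q l) auto
next
  assume xy: "(?x has_vector_derivative ?X) (at s within J) \<and>
      (?y has_vector_derivative ?Y) (at s within J)"
  define x where "x = ?x"
  define y where "y = ?y"
  have x: "(x has_vector_derivative ?X) (at s within J)"
    and y: "(y has_vector_derivative ?Y) (at s within J)"
    using xy by (auto simp: x_def y_def)
  (* the determinant of the linear system, up to sign *)
  have det: "((\<lambda>r. l r * (p r + q r)) has_vector_derivative l s * (p' + q') + l' * (p s + q s))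
      (at s within J)"
    by (intro has_vector_derivative_add has_vector_derivative_mult p q l)
  have nz': "l r * (p r + q r) \<noteq> 0" if "r \<in> J" for r
    using nz that by simp
  have "((\<lambda>r. (l r * x r + q r * y r) * inverse (l r * (p r + q r))) has_vector_derivative U)
      (at s within J)"
    by (rule has_vector_derivative_eq_rhs, rule has_vector_derivative_mult,
        rule has_vector_derivative_add[OF has_vector_derivative_mult[OF l x]
          has_vector_derivative_mult[OF q y]],
        rule has_vector_derivative_inverse[OF det nz'[OF s]])
      (use nz[OF s] in \<open>simp add: x_def y_def divide_simps, simp add: algebra_simps\<close>)
  moreover have "(l r * x r + q r * y r) * inverse (l r * (p r + q r)) = u r" if "r \<in> J" for r
    using nz[OF that] by (simp add: x_def y_def divide_simps) (simp add: algebra_simps)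
  moreover have "((\<lambda>r. (l r * x r - p r * y r) * inverse (l r * (p r + q r))) has_vector_derivative V)
      (at s within J)"
    by (rule has_vector_derivative_eq_rhs, rule has_vector_derivative_mult,
        rule has_vector_derivative_diff[OF has_vector_derivative_mult[OF l x]
          has_vector_derivative_mult[OF p y]],
        rule has_vector_derivative_inverse[OF det nz'[OF s]])
      (use nz[OF s] in \<open>simp add: x_def y_def divide_simps, simp add: algebra_simps\<close>)
  moreover have "(l r * x r - p r * y r) * inverse (l r * (p r + q r)) = v r" if "r \<in> J" for r
    using nz[OF that] by (simp add: x_def y_def divide_simps) (simp add: algebra_simps)
  ultimately show ?R
    by (metis (no_types, lifting) has_vector_derivative_transform[OF s])
qed

lemma cnj_lam: "cnj (lam \<mu> t) = - lam \<mu> t"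
  by (simp add: lam_def)

lemma lam_squared: "\<mu> t \<ge> 0 \<Longrightarrow> lam \<mu> t ^ 2 = - of_real (\<mu> t)"
  by (simp add: lam_def power_mult_distrib flip: of_real_power)

lemma lam_nonzero: "\<mu> t > 0 \<Longrightarrow> lam \<mu> t \<noteq> 0"
  by (simp add: lam_def)

text \<open>In contrast to \<open>lam\<close> itself, this needs differentiability: the default value of
  \<open>vector_derivative\<close> at other points is arbitrary.\<close>

lemma cnj_lam':
  assumes "(lam \<mu> has_vector_derivative lam' \<mu> t) (at t)"
  shows "cnj (lam' \<mu> t) = - lam' \<mu> t"
proof -
  have "((\<lambda>t. cnj (lam \<mu> t)) has_vector_derivative cnj (lam' \<mu> t)) (at t)"
    by (rule bounded_linear.has_vector_derivative[OF bounded_linear_cnj assms])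
  moreover have "((\<lambda>t. cnj (lam \<mu> t)) has_vector_derivative - lam' \<mu> t) (at t)"
    unfolding cnj_lam by (rule has_vector_derivative_minus[OF assms])
  ultimately show ?thesis
    by (rule vector_derivative_unique_at)
qed

text \<open>Only one off-diagonal entry has to be computed: complex conjugation exchanges the two columns of
  the transformation and leaves the matrix of the system unchanged, so the second column of the new
  matrix is the conjugate of the first one with its entries swapped.\<close>

lemma brings_into_form_trafo:
  fixes f \<nu> h :: "real \<Rightarrow> real \<Rightarrow> complex" and f' :: "real \<Rightarrow> complex"
  assumes f': "\<And>t. t \<in> I \<Longrightarrow> ((\<lambda>t. f t \<epsilon>) has_vector_derivative f' t) (at t)"
    and l': "\<And>t. t \<in> I \<Longrightarrow> (lam \<mu> has_vector_derivative lam' \<mu> t) (at t)"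
    and \<mu>: "\<And>t. t \<in> I \<Longrightarrow> \<mu> t > 0"
    and nz: "\<And>t. t \<in> I \<Longrightarrow> f t \<epsilon> + cnj (f t \<epsilon>) \<noteq> 0"
    and h: "\<And>t. t \<in> I \<Longrightarrow> h t \<epsilon> * (f t \<epsilon> + cnj (f t \<epsilon>)) =
      lam \<mu> t - of_real \<epsilon> * f' t
        - f t \<epsilon> * (lam \<mu> t * f t \<epsilon> - of_real \<epsilon> * (lam' \<mu> t / lam \<mu> t))"
    and \<nu>: "\<And>t. t \<in> I \<Longrightarrow>
      \<nu> t \<epsilon> = lam \<mu> t * f t \<epsilon> - of_real \<epsilon> * (lam' \<mu> t / lam \<mu> t) + h t \<epsilon>"
  shows "brings_into_form (UNIV \<times> UNIV \<times> I)
    (trafo \<mu> f \<epsilon>) (orig_field \<mu> \<epsilon>) (new_field \<nu> (\<lambda>t \<epsilon>. cnj (h t \<epsilon>)) h \<epsilon>)"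
proof -
  have lnz: "lam \<mu> t \<noteq> 0" if "t \<in> I" for t
    using lam_nonzero[of \<mu> t] \<mu>[OF that] by simp
  show ?thesis
    unfolding brings_into_form_def
  proof (intro conjI allI impI)
    let ?inv = "\<lambda>(x, y, t). let l = lam \<mu> t; p = f t \<epsilon>; q = cnj p in
       ((l * x + q * y) / (l * (p + q)), (l * x - p * y) / (l * (p + q)), t)"
    show "bij_betw (trafo \<mu> f \<epsilon>) (UNIV \<times> UNIV \<times> I) (UNIV \<times> UNIV \<times> I)"
    proof (rule bij_betw_byWitness[of _ ?inv])
      show "\<forall>z\<in>UNIV \<times> UNIV \<times> I. ?inv (trafo \<mu> f \<epsilon> z) = z"
        using nz lnz by (auto simp: trafo_def Let_def divide_simps) (simp_all add: algebra_simps)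
      show "\<forall>z\<in>UNIV \<times> UNIV \<times> I. trafo \<mu> f \<epsilon> (?inv z) = z"
        using nz lnz by (auto simp: trafo_def Let_def divide_simps) (simp_all add: algebra_simps)
    qed (auto simp: trafo_def Let_def)
  next
    fix J :: "real set" and w :: "real \<Rightarrow> phase"
    assume "is_interval J \<and> w ` J \<subseteq> UNIV \<times> UNIV \<times> I"
    then have wI: "snd (snd (w s)) \<in> I" if "s \<in> J" for s
      using that by (auto simp: image_subset_iff mem_Times_iff)
    define u where "u = (\<lambda>s. fst (w s))"
    define v where "v = (\<lambda>s. fst (snd (w s)))"
    define \<tau> where "\<tau> = (\<lambda>s. snd (snd (w s)))"
    have w: "w = (\<lambda>s. (u s, v s, \<tau> s))"
      by (simp add: u_def v_def \<tau>_def)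
    have \<tau>: "\<tau> s \<in> I" if "s \<in> J" for s
      using wI[OF that] by (simp add: \<tau>_def)
    let ?p = "\<lambda>s. f (\<tau> s) \<epsilon>" and ?l = "\<lambda>s. lam \<mu> (\<tau> s)"
    have "(trafo \<mu> f \<epsilon> \<circ> w has_vector_derivative orig_field \<mu> \<epsilon> ((trafo \<mu> f \<epsilon> \<circ> w) s)) (at s within J)
        \<longleftrightarrow> (w has_vector_derivative new_field \<nu> (\<lambda>t \<epsilon>. cnj (h t \<epsilon>)) h \<epsilon> (w s)) (at s within J)"
      (is "?L \<longleftrightarrow> ?R") if s: "s \<in> J" for s
    proof (cases "(\<tau> has_vector_derivative \<epsilon>) (at s within J)")
      case False
      then show ?thesis
        unfolding w by (simp add: o_def trafo_def orig_field_def new_field_def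
            has_vector_derivative_triple_iff)
    next
      case True
      note t = \<tau>[OF s]
      let ?t = "\<tau> s"
      define P where "P = f ?t \<epsilon>"
      define L where "L = lam \<mu> ?t"
      define L' where "L' = lam' \<mu> ?t"
      define H where "H = h ?t \<epsilon>"
      define E where "E = complex_of_real \<epsilon>"
      define U where "U = \<nu> ?t \<epsilon> * u s + cnj H * v s"
      define V where "V = H * u s + cnj (\<nu> ?t \<epsilon>) * v s"
      have p: "(?p has_vector_derivative E * f' ?t) (at s within J)"
        using vector_diff_chain_within[OF True has_vector_derivative_at_within[OF f'[OF t]]]
        by (simp add: o_def scaleR_conv_of_real E_def)
      have q: "((\<lambda>s. cnj (?p s)) has_vector_derivative E * cnj (f' ?t)) (at s within J)"
        using bounded_linear.has_vector_derivative[OF bounded_linear_cnj p] by (simp add: E_def)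
      have l: "(?l has_vector_derivative E * L') (at s within J)"
        using vector_diff_chain_within[OF True has_vector_derivative_at_within[OF l'[OF t]]]
        by (simp add: o_def scaleR_conv_of_real E_def L'_def)
      have L: "L \<noteq> 0" "cnj L = - L" "cnj L' = - L'" "of_real (\<mu> ?t) = - (L * L)"
        using lnz[OF t] cnj_lam cnj_lam'[OF l'[OF t]] lam_squared[of \<mu> ?t] \<mu>[OF t]
        by (simp_all add: L_def L'_def power2_eq_square)
      define A where "A = L' / L"
      have A: "cnj A = A" "L' = L * A"
        using L by (simp_all add: A_def)
      have H: "H * (P + cnj P) = L - E * f' ?t - P * (L * P - E * A)"
        using h[OF t] by (simp add: H_def P_def L_def L'_def E_def A_def)
      have "cnj (H * (P + cnj P)) = cnj (L - E * f' ?t - P * (L * P - E * A))"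
        by (simp only: H)
      then have cH: "cnj H * (P + cnj P) = - L - E * cnj (f' ?t) + cnj P * (L * cnj P + E * A)"
        using L A by (simp add: E_def algebra_simps)
      have nu: "\<nu> ?t \<epsilon> = L * P - E * A + H"
        using \<nu>[OF t] by (simp add: H_def P_def L_def L'_def E_def A_def)
      then have cnu: "cnj (\<nu> ?t \<epsilon>) = - L * cnj P - E * A + cnj H"
        using L A by (simp add: E_def)
      (* the two equations say that the transformation maps the new field to the original one *)
      have X: "L * u s - L * v s = P * U + E * f' ?t * u s + (cnj P * V + E * cnj (f' ?t) * v s)"
      proof -
        have "P * U + E * f' ?t * u s + (cnj P * V + E * cnj (f' ?t) * v s)
          = (P * (L * P - E * A) + H * (P + cnj P) + E * f' ?t) * u s
           + (cnj H * (P + cnj P) - cnj P * (L * cnj P + E * A) + E * cnj (f' ?t)) * v s"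
          unfolding U_def V_def cnu unfolding nu by (simp add: algebra_simps)
        then show ?thesis
          unfolding H cH by (simp add: algebra_simps)
      qed
      have Y: "- of_real (\<mu> ?t) * (P * u s + cnj P * v s)
          = L * U + E * L' * u s - (L * V + E * L' * v s)"
        unfolding U_def V_def cnu unfolding nu L A by (simp add: algebra_simps)
      have "?L \<longleftrightarrow>
         ((\<lambda>r. ?p r * u r + cnj (?p r) * v r) has_vector_derivative
           P * U + E * f' ?t * u s + (cnj P * V + E * cnj (f' ?t) * v s)) (at s within J) \<and>
         ((\<lambda>r. ?l r * u r - ?l r * v r) has_vector_derivative
           L * U + E * L' * u s - (L * V + E * L' * v s)) (at s within J)"
        unfolding w using True
        by (simp add: o_def trafo_def orig_field_def has_vector_derivative_triple_iff
            flip: X Y P_def L_def)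
      also have "\<dots> \<longleftrightarrow> (u has_vector_derivative U) (at s within J) \<and>
         (v has_vector_derivative V) (at s within J)"
        unfolding P_def L_def
        by (rule linear_change_has_vector_derivative_iff[OF s p q l]) (use nz lnz \<tau> in auto)
      also have "\<dots> \<longleftrightarrow> ?R"
        unfolding w using True
        by (simp add: new_field_def has_vector_derivative_triple_iff U_def V_def H_def)
      finally show ?thesis .
    qed
    then show "solves (orig_field \<mu> \<epsilon>) J (trafo \<mu> f \<epsilon> \<circ> w) \<longleftrightarrow>
        solves (new_field \<nu> (\<lambda>t \<epsilon>. cnj (h t \<epsilon>)) h \<epsilon>) J w"
      unfolding solves_def by blast
  qed
qed

section \<open>The transformation to approximately diagonal form\<close>

text \<open>The sign is positive directly to the right of 0 by the derivative, and the intermediate value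
  theorem propagates it, as there are no further zeros.\<close>

lemma positive_right_of_simple_zero:
  fixes \<mu> :: "real \<Rightarrow> real"
  assumes "is_interval S" "continuous_on S \<mu>" "0 \<in> S"
    and "\<mu> 0 = 0" "(\<mu> has_real_derivative m) (at 0)" "m > 0"
    and nz: "\<And>t. t \<in> S \<Longrightarrow> \<mu> t = 0 \<Longrightarrow> t = 0"
    and "t \<in> S" "t > 0"
  shows "\<mu> t > 0"
proof (rule ccontr)
  assume "\<not> \<mu> t > 0"
  obtain d where d: "d > 0" "\<And>h. 0 < h \<Longrightarrow> h < d \<Longrightarrow> \<mu> 0 < \<mu> (0 + h)"
    using DERIV_pos_inc_right[OF assms(5,6)] by auto
  define s where "s = min (d / 2) t"
  have s: "0 < s" "s \<le> t" "s < d"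
    using d(1) assms(9) by (auto simp: s_def min_def)
  then have \<mu>s: "\<mu> s > 0"
    using d(2)[of s] assms(4) by simp
  have sub: "{s..t} \<subseteq> S"
  proof
    fix r assume "r \<in> {s..t}"
    then show "r \<in> S"
      using mem_is_interval_1_I[OF assms(1,3,8)] s(1) by auto
  qed
  then have "continuous_on {s..t} \<mu>"
    using assms(2) continuous_on_subset by blast
  then obtain r where "s \<le> r" "r \<le> t" "\<mu> r = 0"
    using IVT2'[of \<mu> t 0 s] s \<mu>s \<open>\<not> \<mu> t > 0\<close> by auto
  then show False
    using nz[of r] sub s by auto
qed

theorem lemma2p5:
  fixes \<mu> :: "real \<Rightarrow> real" and Nb :: "real set" and a b :: real and k N :: nat
  assumes "open Nb" and "is_interval Nb" and "0 \<in> Nb"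
    and "Ck_on k \<mu> Nb" and "k \<ge> N + 1"
    and "\<mu> 0 = 0" and "deriv \<mu> 0 > 0"
    and "\<forall>t\<in>Nb. \<mu> t = 0 \<longleftrightarrow> t = 0"
    and "0 < a" and "a < b" and "{a..b} \<subseteq> Nb"
  shows "\<exists>f :: real \<Rightarrow> real \<Rightarrow> complex.
    (\<forall>\<epsilon>. Ck_on (k - N) (\<lambda>t. f t \<epsilon>) {a..b}) \<and>
    (\<forall>t\<in>{a..b}. \<exists>p :: complex poly. degree p \<le> N \<and> (\<forall>\<epsilon>. f t \<epsilon> = poly p (of_real \<epsilon>))) \<and>
    (\<exists>\<nu> T g h :: real \<Rightarrow> real \<Rightarrow> complex. \<exists>\<epsilon>\<^sub>0>0.
      (\<forall>\<epsilon>. 0 \<le> \<epsilon> \<and> \<epsilon> < \<epsilon>\<^sub>0 \<longrightarrow>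
        brings_into_form (UNIV \<times> UNIV \<times> {a..b})
          (trafo \<mu> f \<epsilon>) (orig_field \<mu> \<epsilon>) (new_field \<nu> g h \<epsilon>)) \<and>
      unif_bigo {a..b} (N + 1) g \<and>
      unif_bigo {a..b} (N + 1) h \<and>
      unif_bigo {a..b} (N + 1)
        (\<lambda>t \<epsilon>. \<nu> t \<epsilon> - (lam \<mu> t * f t \<epsilon> - of_real \<epsilon> * inverse (lam \<mu> t) * lam' \<mu> t)) \<and>
      (\<forall>\<epsilon>. \<bar>\<epsilon>\<bar> < \<epsilon>\<^sub>0 \<longrightarrow> Ck_on (k - N - 1) (\<lambda>t. \<nu> t \<epsilon>) {a..b}) \<and>
      (\<forall>t\<in>{a..b}. real_analytic_on (\<nu> t) {-\<epsilon>\<^sub>0<..<\<epsilon>\<^sub>0}) \<and>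
      (\<forall>t\<in>{a..b}. \<forall>\<epsilon>. \<bar>\<epsilon>\<bar> < \<epsilon>\<^sub>0 \<longrightarrow>
        \<nu> t \<epsilon> = lam \<mu> t - 1/2 * inverse (lam \<mu> t) * lam' \<mu> t * of_real \<epsilon>
          + of_real \<epsilon> ^ 2 * T t \<epsilon>) \<and>
      (\<forall>\<epsilon>. \<bar>\<epsilon>\<bar> < \<epsilon>\<^sub>0 \<longrightarrow> Ck_on (k - N - 1) (\<lambda>t. T t \<epsilon>) {a..b}) \<and>
      (\<forall>t\<in>{a..b}. real_analytic_on (T t) {-\<epsilon>\<^sub>0<..<\<epsilon>\<^sub>0}))"
proof -
  (* An open set around the interval on which \<mu> is positive, so that all derivatives in the
     construction are two-sided ones. *)
  define S where "S = Nb \<inter> {0<..}"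
  have S: "open S"
    unfolding S_def using assms(1) by (intro open_Int open_greaterThan)
  have I: "{a..b} \<subseteq> S"
    using assms(9,11) by (auto simp: S_def)
  have k1: "Ck_on (Suc 0) \<mu> Nb"
    using Ck_on_mono[OF assms(4)] assms(5) by simp
  have \<mu>_pos: "\<mu> t > 0" if "t \<in> S" for t
  proof (rule positive_right_of_simple_zero[of Nb \<mu> "deriv \<mu> 0"])
    have "(\<mu> has_real_derivative vector_derivative \<mu> (at 0)) (at 0)"
      using Ck_on_open_derivative(2)[OF k1 assms(1,3)]
      by (simp add: has_real_derivative_iff_has_vector_derivative)
    then show "(\<mu> has_real_derivative deriv \<mu> 0) (at 0)"
      using DERIV_imp_deriv by metis
    show "continuous_on Nb \<mu>"
      using assms(4) by (rule Ck_on_imp_continuous_on)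
  qed (use assms that in \<open>auto simp: S_def\<close>)
  define l where "l = lam \<mu>"
  have lk: "Ck_on k l S"
  proof -
    have "Ck_on k (\<lambda>t. sqrt (\<mu> t)) S"
      using \<mu>_pos Ck_on_subset[OF assms(4)] by (intro Ck_on_sqrt) (auto simp: S_def)
    then have "Ck_on k (\<lambda>t. \<i> * complex_of_real (sqrt (\<mu> t))) S"
      by (intro Ck_on_mult Ck_on_const Ck_on_linear[OF bounded_linear_of_real])
    then show ?thesis
      by (simp add: l_def lam_def[abs_def])
  qed
  have l_nz: "l t \<noteq> 0" if "t \<in> S" for t
    using lam_nonzero[of \<mu> t] \<mu>_pos[OF that] by (simp add: l_def)
  have l': "(l has_vector_derivative lam' \<mu> t) (at t)" if "t \<in> S" for t
    using Ck_on_open_derivative(2)[OF Ck_on_mono[OF lk] S that, of 0] assms(5)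
    by (simp add: l_def lam'_def)
  have l'_eq: "vector_derivative l (at t) = lam' \<mu> t" for t
    by (simp add: l_def lam'_def)
  note ctx = S lk l_nz assms(5)

  define P where "P = wkb_poly l N"
  define f where "f = (\<lambda>t \<epsilon>. poly (P t) (complex_of_real \<epsilon>))"
  define q where "q = (\<lambda>t. P t + map_poly cnj (P t))"
  define Q where "Q = (\<lambda>t. poly_shift (Suc N) (riccati_residual l N t))"
  define A where "A = (\<lambda>t. lam' \<mu> t / l t)"
  define h where "h = (\<lambda>t \<epsilon>. of_real \<epsilon> ^ (N + 1) * poly (Q t) (of_real \<epsilon>) / poly (q t) (of_real \<epsilon>))"
  define \<nu> where "\<nu> = (\<lambda>t \<epsilon>. l t * f t \<epsilon> - of_real \<epsilon> * A t + h t \<epsilon>)"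
  (* For N > 0 the square of \<epsilon> can be split off from the power of \<epsilon> in h. For N = 0 the term h is
     linear in \<epsilon> and turns the first-order coefficient - A into - A / 2; nothing is left over. *)
  define T where "T = (\<lambda>t \<epsilon>. if N = 0 then 0 else
      l t * poly (poly_shift 2 (P t)) (of_real \<epsilon>)
        + of_real \<epsilon> ^ (N - 1) * poly (Q t) (of_real \<epsilon>) / poly (q t) (of_real \<epsilon>))"

  have q_eq: "poly (q t) (of_real \<epsilon>) = f t \<epsilon> + cnj (f t \<epsilon>)" for t \<epsilon>
    using poly_cnj[of "P t" "of_real \<epsilon>"] by (simp add: q_def f_def)

  have P_Ck: "Ck_poly (k - N) {a..b} P"
    using Ck_poly_subset[OF Ck_poly_wkb_poly[OF ctx] I] by (simp add: P_def)
  have P_Ck1: "Ck_poly (k - N - 1) {a..b} P"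
    using Ck_poly_mono[OF P_Ck] by simp
  have q_Ck: "Ck_poly (k - N - 1) {a..b} q"
    unfolding q_def by (intro Ck_poly_add Ck_poly_cnj P_Ck1)
  have Q_Ck: "Ck_poly (k - N - 1) {a..b} Q"
    unfolding Q_def
    by (intro Ck_poly_shift Ck_poly_subset[OF Ck_poly_riccati_residual[OF ctx] I])
  have A_Ck: "Ck_on (k - N - 1) A {a..b}"
    using Ck_on_subset[OF Ck_on_log_deriv[OF ctx] I] by (simp add: A_def l'_eq)
  have l_Ck: "Ck_on (k - N - 1) l {a..b}"
    using Ck_on_subset[OF Ck_on_mono[OF lk] I] by simp

  (* The bound C controls f - 1, divided by \<epsilon>; the choice of e0 makes the real part of f at
     least 1/2 and thus the denominator at least 1. *)
  obtain C where C: "C \<ge> 0"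
    "\<And>t z. t \<in> {a..b} \<Longrightarrow> norm z \<le> 1 \<Longrightarrow> norm (poly (poly_shift 1 (P t)) z) \<le> C"
    using Ck_poly_bounded[OF Ck_poly_shift[OF P_Ck, of 1] compact_Icc] by blast
  obtain B where B: "B \<ge> 0" "\<And>t z. t \<in> {a..b} \<Longrightarrow> norm z \<le> 1 \<Longrightarrow> norm (poly (Q t) z) \<le> B"
    using Ck_poly_bounded[OF Q_Ck compact_Icc] by blast
  define e0 where "e0 = 1 / (2 * C + 1)"
  have e0: "e0 > 0" "e0 \<le> 1" "e0 * C \<le> 1 / 2"
    using C(1) by (auto simp: e0_def field_simps)
  have q_ge: "norm (poly (q t) (of_real \<epsilon>)) \<ge> 1" if t: "t \<in> {a..b}" and \<epsilon>: "\<bar>\<epsilon>\<bar> < e0" for t \<epsilon>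
  proof -
    let ?D = "poly (poly_shift 1 (P t)) (complex_of_real \<epsilon>)"
    have "P t = pCons 1 (poly_shift 1 (P t))"
      by (auto simp: poly_eq_iff coeff_pCons coeff_poly_shift P_def coeff_wkb_poly split: nat.split)
    then have "poly (P t) (of_real \<epsilon>) = poly (pCons 1 (poly_shift 1 (P t))) (complex_of_real \<epsilon>)"
      by simp
    then have "f t \<epsilon> = 1 + of_real \<epsilon> * ?D"
      by (simp add: f_def)
    moreover have "norm (of_real \<epsilon> * ?D) \<le> e0 * C"
      unfolding norm_mult using C(2)[OF t, of "of_real \<epsilon>"] \<epsilon> e0 C(1)
      by (intro mult_mono) auto
    then have "\<bar>Re (of_real \<epsilon> * ?D)\<bar> \<le> 1 / 2"
      using abs_Re_le_cmod[of "of_real \<epsilon> * ?D"] e0 by linarith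
    ultimately have "Re (f t \<epsilon>) \<ge> 1 / 2"
      by simp
    then have "Re (poly (q t) (of_real \<epsilon>)) \<ge> 1"
      by (simp add: q_eq)
    then show ?thesis
      using complex_Re_le_cmod order_trans by blast
  qed
  then have q_nz: "poly (q t) (of_real \<epsilon>) \<noteq> 0" if "t \<in> {a..b}" "\<bar>\<epsilon>\<bar> < e0" for t \<epsilon>
    using that by fastforce

  have form: "brings_into_form (UNIV \<times> UNIV \<times> {a..b})
      (trafo \<mu> f \<epsilon>) (orig_field \<mu> \<epsilon>) (new_field \<nu> (\<lambda>t \<epsilon>. cnj (h t \<epsilon>)) h \<epsilon>)"
    if \<epsilon>: "0 \<le> \<epsilon> \<and> \<epsilon> < e0" for \<epsilon>
  proof (rule brings_into_form_trafo[where f' = "\<lambda>t. poly (wkb_poly_deriv l N t) (of_real \<epsilon>)"])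
    fix t assume t: "t \<in> {a..b}"
    then have tS: "t \<in> S"
      using I by auto
    show "((\<lambda>t. f t \<epsilon>) has_vector_derivative poly (wkb_poly_deriv l N t) (of_real \<epsilon>)) (at t)"
      unfolding f_def P_def by (rule wkb_poly_has_vector_derivative[OF ctx tS])
    show "(lam \<mu> has_vector_derivative lam' \<mu> t) (at t)"
      using l'[OF tS] by (simp add: l_def)
    show "\<mu> t > 0"
      using \<mu>_pos[OF tS] .
    have nz: "poly (q t) (of_real \<epsilon>) \<noteq> 0"
      using q_nz[OF t] \<epsilon> by simp
    then show "f t \<epsilon> + cnj (f t \<epsilon>) \<noteq> 0"
      by (simp add: q_eq)
    have "h t \<epsilon> * (f t \<epsilon> + cnj (f t \<epsilon>)) = of_real \<epsilon> ^ Suc N * poly (Q t) (of_real \<epsilon>)"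
      using nz by (simp add: h_def flip: q_eq)
    then show "h t \<epsilon> * (f t \<epsilon> + cnj (f t \<epsilon>)) =
        lam \<mu> t - of_real \<epsilon> * poly (wkb_poly_deriv l N t) (of_real \<epsilon>)
          - f t \<epsilon> * (lam \<mu> t * f t \<epsilon> - of_real \<epsilon> * (lam' \<mu> t / lam \<mu> t))"
      using poly_riccati_residual[of l t, where z = "of_real \<epsilon>" and N = N] l_nz[OF tS]
      by (simp add: Q_def f_def P_def lam'_def l_def power2_eq_square algebra_simps)
    show "\<nu> t \<epsilon> = lam \<mu> t * f t \<epsilon> - of_real \<epsilon> * (lam' \<mu> t / lam \<mu> t) + h t \<epsilon>"
      by (simp add: \<nu>_def l_def A_def)
  qed

  have h_bigo: "unif_bigo {a..b} (N + 1) h"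
    unfolding unif_bigo_def
  proof (rule exI[of _ B], rule exI[of _ e0], intro conjI ballI allI impI)
    fix t \<epsilon> assume t: "t \<in> {a..b}" and \<epsilon>: "0 \<le> \<epsilon> \<and> \<epsilon> < e0"
    have "norm (h t \<epsilon>) = \<epsilon> ^ (N + 1) * norm (poly (Q t) (of_real \<epsilon>)) / norm (poly (q t) (of_real \<epsilon>))"
      using \<epsilon> by (simp add: h_def norm_mult norm_divide norm_power)
    also have "\<dots> \<le> \<epsilon> ^ (N + 1) * B / 1"
      using \<epsilon> e0 B(1) B(2)[OF t, of "of_real \<epsilon>"] q_ge[OF t, of \<epsilon>]
      by (intro frac_le mult_left_mono) auto
    finally show "norm (h t \<epsilon>) \<le> B * \<epsilon> ^ (N + 1)"
      by (simp add: mult.commute)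
  qed (rule e0)

  have A_eq: "A t = inverse (lam \<mu> t) * lam' \<mu> t" for t
    by (simp add: A_def l_def divide_inverse)

  have c1: "wkb_coeff l (Suc 0) t = A t / (2 * l t)" for t
    by (simp add: wkb_coeff.simps(2) A_def l'_eq One_nat_def)

  define R where "R = (\<lambda>t. monom (l t) 0 * P t - monom (A t) 1)"
  have \<nu>_rat: "\<nu> t \<epsilon> = poly (R t * q t + monom 1 (N + 1) * Q t) (of_real \<epsilon>) / poly (q t) (of_real \<epsilon>)"
    if "t \<in> {a..b}" "\<bar>\<epsilon>\<bar> < e0" for t \<epsilon>
    using q_nz[OF that] by (simp add: \<nu>_def h_def R_def f_def poly_monom field_simps)
  define pT where "pT = (\<lambda>t. if N = 0 then 0 else
     monom (l t) 0 * poly_shift 2 (P t) * q t + monom 1 (N - 1) * Q t)"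
  have T_rat: "T t \<epsilon> = poly (pT t) (of_real \<epsilon>) / poly (q t) (of_real \<epsilon>)"
    if "t \<in> {a..b}" "\<bar>\<epsilon>\<bar> < e0" for t \<epsilon>
    using q_nz[OF that] by (simp add: T_def pT_def poly_monom field_simps)

  have \<nu>_Ck: "Ck_poly (k - N - 1) {a..b} (\<lambda>t. R t * q t + monom 1 (N + 1) * Q t)"
    unfolding R_def
    by (intro Ck_poly_add Ck_poly_diff Ck_poly_mult Ck_poly_monom Ck_on_const l_Ck A_Ck P_Ck1 q_Ck Q_Ck)
  have T_Ck: "Ck_poly (k - N - 1) {a..b} pT"
  proof (cases "N = 0")
    case True
    then show ?thesis
      using Ck_poly_monom[OF Ck_on_const[of _ 0]] by (simp add: pT_def)
  next
    case False
    then have "pT = (\<lambda>t. monom (l t) 0 * poly_shift 2 (P t) * q t + monom 1 (N - 1) * Q t)"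
      by (simp add: pT_def)
    then show ?thesis
      by (simp only:) (intro Ck_poly_add Ck_poly_mult Ck_poly_monom Ck_poly_shift Ck_on_const
          l_Ck P_Ck1 q_Ck Q_Ck)
  qed

  have regular: "Ck_on (k - N - 1) (\<lambda>t. F t \<epsilon>) {a..b}"
    if "Ck_poly (k - N - 1) {a..b} p" "\<bar>\<epsilon>\<bar> < e0"
      "\<And>t \<epsilon>. t \<in> {a..b} \<Longrightarrow> \<bar>\<epsilon>\<bar> < e0 \<Longrightarrow> F t \<epsilon> = poly (p t) (of_real \<epsilon>) / poly (q t) (of_real \<epsilon>)"
    for F p \<epsilon>
    using Ck_on_divide_poly[OF that(1) q_Ck q_nz[OF _ that(2)]]
      Ck_on_cong[of "{a..b}" "\<lambda>t. F t \<epsilon>", OF that(3)[OF _ that(2)]] by simp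
  have analytic: "real_analytic_on (F t) {-e0<..<e0}"
    if "t \<in> {a..b}"
      "\<And>t \<epsilon>. t \<in> {a..b} \<Longrightarrow> \<bar>\<epsilon>\<bar> < e0 \<Longrightarrow> F t \<epsilon> = poly (p t) (of_real \<epsilon>) / poly (q t) (of_real \<epsilon>)"
    for F p t
    using that by (intro real_analytic_on_rational[of _ "q t" _ "p t"] q_nz) auto

  have expansion: "\<nu> t \<epsilon> = lam \<mu> t - 1/2 * inverse (lam \<mu> t) * lam' \<mu> t * of_real \<epsilon>
      + of_real \<epsilon> ^ 2 * T t \<epsilon>" if t: "t \<in> {a..b}" and \<epsilon>: "\<bar>\<epsilon>\<bar> < e0" for t \<epsilon>
  proof -
    have tS: "t \<in> S"
      using I t by auto
    have "\<nu> t \<epsilon> = l t - 1/2 * A t * of_real \<epsilon> + of_real \<epsilon> ^ 2 * T t \<epsilon>"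
    proof (cases "N = 0")
      case True
      (* the residual is exactly \<epsilon> times the logarithmic derivative, and the denominator is 2 *)
      have "P t = 1"
        using True by (simp add: P_def wkb_poly_def one_poly_eq_simps)
      moreover have "wkb_poly_deriv l N t = 0"
        using True by (simp add: wkb_poly_deriv_def)
      then have "riccati_residual l N t = monom (A t) 1"
        using \<open>P t = 1\<close> by (simp add: riccati_residual_def A_def l'_eq flip: P_def)
      then have "Q t = monom (A t) 0"
        using True by (simp add: Q_def poly_shift_monom)
      ultimately show ?thesis
        using True by (simp add: \<nu>_def T_def h_def f_def q_def poly_monom)
    next
      case False
      have "P t = pCons 1 (pCons (wkb_coeff l 1 t) (poly_shift 2 (P t)))"
        using False
        by (auto simp: poly_eq_iff coeff_pCons coeff_poly_shift P_def coeff_wkb_poly split: nat.split)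
      then have "poly (P t) (of_real \<epsilon>)
          = poly (pCons 1 (pCons (wkb_coeff l 1 t) (poly_shift 2 (P t)))) (of_real \<epsilon>)"
        by simp
      then have f_eq: "f t \<epsilon> = 1 + of_real \<epsilon> * (A t / (2 * l t))
          + of_real \<epsilon> ^ 2 * poly (poly_shift 2 (P t)) (of_real \<epsilon>)"
        by (simp add: f_def c1 power2_eq_square algebra_simps)
      have lf: "l t * f t \<epsilon> = l t + of_real \<epsilon> * A t / 2
          + of_real \<epsilon> ^ 2 * (l t * poly (poly_shift 2 (P t)) (of_real \<epsilon>))"
        using l_nz[OF tS] unfolding f_eq by (simp add: field_simps)
      have pow: "complex_of_real \<epsilon> ^ (N + 1) = of_real \<epsilon> ^ 2 * of_real \<epsilon> ^ (N - 1)"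
        using False by (simp flip: power_add)
      show ?thesis
        using False unfolding \<nu>_def h_def T_def lf pow by (simp add: algebra_simps)
    qed
    then show ?thesis
      by (simp only: A_eq l_def mult.assoc)
  qed

  have f_Ck: "\<forall>\<epsilon>. Ck_on (k - N) (\<lambda>t. f t \<epsilon>) {a..b}"
    unfolding f_def by (intro allI Ck_on_poly[OF P_Ck])
  have f_poly: "\<forall>t\<in>{a..b}. \<exists>p. degree p \<le> N \<and> (\<forall>\<epsilon>. f t \<epsilon> = poly p (of_real \<epsilon>))"
  proof
    fix t
    show "\<exists>p. degree p \<le> N \<and> (\<forall>\<epsilon>. f t \<epsilon> = poly p (of_real \<epsilon>))"
      by (rule exI[of _ "P t"]) (simp add: f_def P_def degree_wkb_poly)
  qed
  show ?thesis
  proof (rule exI[of _ f], rule conjI[OF f_Ck conjI[OF f_poly]], rule exI[of _ \<nu>],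
      rule exI[of _ T], rule exI[of _ "\<lambda>t \<epsilon>. cnj (h t \<epsilon>)"], rule exI[of _ h],
      rule exI[of _ e0], intro conjI allI ballI impI)
    show "unif_bigo {a..b} (N + 1) (\<lambda>t \<epsilon>. cnj (h t \<epsilon>))"
      using h_bigo by (simp add: unif_bigo_def)
    show "unif_bigo {a..b} (N + 1)
        (\<lambda>t \<epsilon>. \<nu> t \<epsilon> - (lam \<mu> t * f t \<epsilon> - of_real \<epsilon> * inverse (lam \<mu> t) * lam' \<mu> t))"
    proof -
      have "\<nu> t \<epsilon> - (lam \<mu> t * f t \<epsilon> - of_real \<epsilon> * inverse (lam \<mu> t) * lam' \<mu> t) = h t \<epsilon>" for t \<epsilon>
        by (simp add: \<nu>_def A_eq l_def mult.assoc)
      then show ?thesis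
        using h_bigo by simp
    qed
    show "Ck_on (k - N - 1) (\<lambda>t. \<nu> t \<epsilon>) {a..b}" if "\<bar>\<epsilon>\<bar> < e0" for \<epsilon>
      by (rule regular[OF \<nu>_Ck that \<nu>_rat])
    show "Ck_on (k - N - 1) (\<lambda>t. T t \<epsilon>) {a..b}" if "\<bar>\<epsilon>\<bar> < e0" for \<epsilon>
      by (rule regular[OF T_Ck that T_rat])
    show "real_analytic_on (\<nu> t) {-e0<..<e0}" if "t \<in> {a..b}" for t
      by (rule analytic[OF that \<nu>_rat])
    show "real_analytic_on (T t) {-e0<..<e0}" if "t \<in> {a..b}" for t
      by (rule analytic[OF that T_rat])
  qed (fact form h_bigo e0(1) expansion)+
qed

end
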